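(* Suppose the action set $\mathcal{U}$ and the observation set are finite. Then for every $t\in\{0,1,\dots,T\}$ the value function $V_t^*$ is piecewise-linear (and convex) in $\sigma$: there is a finite set $\Gamma_t$ of functions $\alpha_t^i:\mathcal{S}\to\mathbb{R}$, not depending on $\sigma$, such that $V_t^*(\sigma)=\max_{\alpha_t^i\in\Gamma_t}\langle\alpha_t^i,\sigma\rangle$ for every sufficient statistic $\sigma$.
   Context: Hybrid system. The state is $s=(x,q)\in\mathcal{S}=\mathcal{X}\times\mathcal{Q}$ with $\mathcal{X}\subseteq\mathbb{R}^n$ and $\mathcal{Q}$ a finite set of modes (functions on $\mathcal{X}$ are extended by zero to $\mathbb{R}^n$). The transition kernel has the form $\tau(x',q'\mid x,q,u)=T_x(x'\mid x,u,q')\,T_q(q'\mid x,q,u)$, where $T_q(\cdot\mid x,q,u)$ is a probability distribution on $\mathcal{Q}$ and $T_x(\cdot\mid x,u,q')$ is a probability density on $\mathbb{R}^n$, both measurable in their arguments. $K\subseteq\mathcal{X}\times\mathcal{Q}$ is a Borel set (the safe set), $\mathbf{1}_K$ its indicator function, and $T\in\mathbb{N}$ the time horizon. Observations $y=(y^x,y^q)$: $y^q$ takes values in a finite set of $N_{y^q}$ elements and $Q_{q,y^q}(u)$ is the probability of observing $y^q$ when the mode is $q$ and the preceding control was $u$; $y^x$ takes values in a finite set of $N_{y^x}$ elements and $\varphi(y^x\mid x,u)$ is the probability of observing $y^x$ when the continuous state is $x$ and the preceding control was $u$. Sufficient statistics are nonnegative integrable functions $\sigma$ on $\mathcal{S}$,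 and $\langle f,g\rangle=\sum_{q\in\mathcal{Q}}\int_{\mathbb{R}^n} f(x,q)g(x,q)\,dx$. The update operator is $$\Phi_{y,u}[\sigma](x',q')=N_{y^q}N_{y^x}\,Q_{q',y^q}(u)\,\varphi(y^x\mid x',u)\sum_{q\in\mathcal{Q}}\int_{\mathbb{R}^n}\mathbf{1}_K(x,q)\,\tau(x',q'\mid x,q,u)\,\sigma(x,q)\,dx .$$ Value functions: $V_T^*(\sigma)=\langle\sigma,\mathbf{1}_K\rangle$ and, for $t<T$, $$V_t^*(\sigma)=\sup_{u\in\mathcal{U}}\mathbb{E}^{\dagger}[V_{t+1}^*(\Phi_{y,u}[\sigma])]=\sup_{u\in\mathcal{U}}\frac{1}{N_{y^q}N_{y^x}}\sum_{y}V_{t+1}^*(\Phi_{y,u}[\sigma]),$$ where $\mathbb{E}^\dagger$ is expectation under the reference measure making $y$ uniform on its $N_{y^q}N_{y^x}$ values. *)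

theory Defs
  imports "HOL-Analysis.Analysis"
begin

text \<open>
  The finite sets of modes, of discrete observations and of continuous observations are the
  (nonempty) types \<open>'q\<close>, \<open>'a\<close>, \<open>'b\<close> of class \<open>finite\<close>; the action set is the type \<open>'u\<close>, on which no
  finiteness is imposed here. The continuous state space \<open>cstates M\<close> is a subset of \<open>real ^ 'n\<close>.
  Arguments are written in the order of the mathematical notation, e.g.
  \<open>Tx M x' x u q'\<close> for \<open>T_x(x' | x, u, q')\<close>.
\<close>

record ('n::finite, 'q, 'u, 'a, 'b) hybrid_model =
  cstates :: "(real ^ 'n) set"
  Tx :: "real ^ 'n \<Rightarrow> real ^ 'n \<Rightarrow> 'u \<Rightarrow> 'q \<Rightarrow> real"
  Tq :: "'q \<Rightarrow> real ^ 'n \<Rightarrow> 'q \<Rightarrow> 'u \<Rightarrow> real"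
  Qobs :: "'q \<Rightarrow> 'a \<Rightarrow> 'u \<Rightarrow> real"
  phi :: "'b \<Rightarrow> real ^ 'n \<Rightarrow> 'u \<Rightarrow> real"
  safe :: "((real ^ 'n) \<times> 'q) set"

text \<open>
  Functions on the continuous state space are extended by zero; for \<open>phi\<close> this is required
  explicitly. For \<open>Tx\<close> and \<open>Tq\<close> any Borel extension in the conditioning state \<open>x\<close> is admitted,
  since they are only ever used for \<open>x\<close> in the safe set. Likewise \<open>Tx\<close> is only required to be a
  density on all of \<open>real ^ 'n\<close>: mass it may put outside \<open>cstates M\<close> is removed by \<open>phi\<close>.
  The zero extension and the measurability of \<open>phi\<close> force \<open>cstates M\<close> to be a Borel set.
\<close>

definition hybrid_system :: "('n::finite, 'q::finite, 'u, 'a::finite, 'b::finite) hybrid_model \<Rightarrow> bool"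
  where "hybrid_system M \<longleftrightarrow>
    safe M \<subseteq> cstates M \<times> UNIV \<and>
    (\<forall>q. {x. (x, q) \<in> safe M} \<in> sets borel) \<and>
    (\<forall>u q'. (\<lambda>(x', x). Tx M x' x u q') \<in> borel_measurable borel) \<and>
    (\<forall>x\<in>cstates M. \<forall>u q'.
       (\<forall>x'. 0 \<le> Tx M x' x u q') \<and> has_bochner_integral lborel (\<lambda>x'. Tx M x' x u q') 1) \<and>
    (\<forall>q' q u. (\<lambda>x. Tq M q' x q u) \<in> borel_measurable borel) \<and>
    (\<forall>x\<in>cstates M. \<forall>q u.
       (\<forall>q'. 0 \<le> Tq M q' x q u) \<and> (\<Sum>q'\<in>UNIV. Tq M q' x q u) = 1) \<and>
    (\<forall>q u. (\<forall>yq. 0 \<le> Qobs M q yq u) \<and> (\<Sum>yq\<in>UNIV. Qobs M q yq u) = 1) \<and>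
    (\<forall>yx u. (\<lambda>x. phi M yx x u) \<in> borel_measurable borel) \<and>
    (\<forall>x\<in>cstates M. \<forall>u.
       (\<forall>yx. 0 \<le> phi M yx x u) \<and> (\<Sum>yx\<in>UNIV. phi M yx x u) = 1) \<and>
    (\<forall>x. x \<notin> cstates M \<longrightarrow> (\<forall>yx u. phi M yx x u = 0))"

definition tau :: "('n::finite, 'q, 'u, 'a, 'b) hybrid_model \<Rightarrow>
    real ^ 'n \<Rightarrow> 'q \<Rightarrow> real ^ 'n \<Rightarrow> 'q \<Rightarrow> 'u \<Rightarrow> real"
  where "tau M x' q' x q u = Tx M x' x u q' * Tq M q' x q u"

definition pairing :: "((real ^ 'n::finite) \<times> 'q::finite \<Rightarrow> real) \<Rightarrow> ((real ^ 'n) \<times> 'q \<Rightarrow> real) \<Rightarrow> real"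
  where "pairing f g = (\<Sum>q\<in>UNIV. (\<integral>x. f (x, q) * g (x, q) \<partial>lborel))"

definition zero_extended ::
    "('n::finite, 'q, 'u, 'a, 'b) hybrid_model \<Rightarrow> ((real ^ 'n) \<times> 'q \<Rightarrow> real) \<Rightarrow> bool"
  where "zero_extended M f \<longleftrightarrow> (\<forall>x q. x \<notin> cstates M \<longrightarrow> f (x, q) = 0)"

definition sufficient_statistics ::
    "('n::finite, 'q, 'u, 'a, 'b) hybrid_model \<Rightarrow> ((real ^ 'n) \<times> 'q \<Rightarrow> real) set"
  where "sufficient_statistics M =
    {\<sigma>. zero_extended M \<sigma> \<and> (\<forall>s. 0 \<le> \<sigma> s) \<and> (\<forall>q. integrable lborel (\<lambda>x. \<sigma> (x, q)))}"

definition Phi :: "('n::finite, 'q::finite, 'u, 'a::finite, 'b::finite) hybrid_model \<Rightarrow>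
    'a \<times> 'b \<Rightarrow> 'u \<Rightarrow> ((real ^ 'n) \<times> 'q \<Rightarrow> real) \<Rightarrow> ((real ^ 'n) \<times> 'q \<Rightarrow> real)"
  where "Phi M y u \<sigma> = (\<lambda>(x', q').
    real CARD('a) * real CARD('b) * Qobs M q' (fst y) u * phi M (snd y) x' u *
    (\<Sum>q\<in>UNIV. (\<integral>x. indicator (safe M) (x, q) * tau M x' q' x q u * \<sigma> (x, q) \<partial>lborel)))"

text \<open>\<open>value_fn M T t\<close> is \<open>V_t^*\<close> for the time horizon \<open>T\<close>; it is meant for \<open>t \<le> T\<close>.\<close>

function value_fn :: "('n::finite, 'q::finite, 'u, 'a::finite, 'b::finite) hybrid_model \<Rightarrow>
    nat \<Rightarrow> nat \<Rightarrow> ((real ^ 'n) \<times> 'q \<Rightarrow> real) \<Rightarrow> real"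
  where "value_fn M T t \<sigma> =
    (if t < T
     then (SUP u. 1 / (real CARD('a) * real CARD('b)) *
            (\<Sum>y\<in>UNIV. value_fn M T (Suc t) (Phi M y u \<sigma>)))
     else pairing \<sigma> (indicator (safe M)))"
  by auto
termination
  by (relation "Wellfounded.measure (\<lambda>(M, T, t, \<sigma>). T - t)") auto

declare value_fn.simps [simp del]

end

theory Submission
  imports Defs
begin

text \<open>
  Each update \<open>\<Phi>\<^bsub>y,u\<^esub>\<close> is linear in \<open>\<sigma>\<close> and, by Fubini, has an adjoint on bounded Borel functions, so
  \<open>\<langle>\<alpha>, \<Phi>\<^bsub>y,u\<^esub>[\<sigma>]\<rangle>\<close> is again a linear functional of \<open>\<sigma>\<close>. Backwards in time, a maximum over \<open>u\<close> of a
  sum over \<open>y\<close> of maxima over \<open>\<Gamma>\<close> is the maximum over pairs of a control \<open>u\<close> and a choice function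
  from the observations to \<open>\<Gamma>\<close>, of which there are finitely many.
\<close>

section \<open>Integrability and Fubini for a density kernel\<close>

lemma density_integrable_mult:
  fixes k g :: "'x::euclidean_space \<Rightarrow> real"
  assumes k: "\<And>x. 0 \<le> k x" "has_bochner_integral lborel k 1"
    and g: "g \<in> borel_measurable borel" and bound: "\<And>x. \<bar>g x\<bar> \<le> B"
  shows "integrable lborel (\<lambda>x. g x * k x)" and "(\<integral>x. \<bar>g x * k x\<bar> \<partial>lborel) \<le> B"
proof -
  have ki: "integrable lborel k" "integral\<^sup>L lborel k = 1"
    using k(2) by (auto simp: has_bochner_integral_iff)
  then have km: "k \<in> borel_measurable lborel"
    by auto
  have Bk: "integrable lborel (\<lambda>x. B * k x)"
    using ki by simp
  have le: "\<bar>g x * k x\<bar> \<le> B * k x" for x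
    using mult_right_mono[OF bound k(1)] k(1)[of x] by (simp add: abs_mult)
  then show gk: "integrable lborel (\<lambda>x. g x * k x)"
    using km g by (intro Bochner_Integration.integrable_bound[OF Bk]) (auto intro!: AE_I2 order_trans[OF le abs_ge_self])
  have "(\<integral>x. \<bar>g x * k x\<bar> \<partial>lborel) \<le> (\<integral>x. B * k x \<partial>lborel)"
    using gk le Bk by (intro Bochner_Integration.integral_mono) auto
  then show "(\<integral>x. \<bar>g x * k x\<bar> \<partial>lborel) \<le> B"
    using ki by simp
qed

text \<open>Integrating over \<open>x'\<close> first, a density in \<open>x'\<close> leaves at most
  \<open>B * \<bar>h x\<bar>\<close>, which is integrable, so Fubini's criterion applies. The kernel
  is known to be a density only for \<open>x\<close> in \<open>C\<close>; elsewhere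
  \<open>h\<close>, and with it the integrand, vanishes.\<close>

lemma kernel_integrable_pair:
  fixes k :: "'x::euclidean_space \<Rightarrow> 'x \<Rightarrow> real" and g h :: "'x \<Rightarrow> real"
  assumes k: "(\<lambda>(x', x). k x' x) \<in> borel_measurable borel"
    and dens: "\<And>x x'. x \<in> C \<Longrightarrow> 0 \<le> k x' x"
      "\<And>x. x \<in> C \<Longrightarrow> has_bochner_integral lborel (\<lambda>x'. k x' x) 1"
    and g [measurable]: "g \<in> borel_measurable borel" and bound: "\<And>x'. \<bar>g x'\<bar> \<le> B"
    and h: "integrable lborel h" and h0: "\<And>x. x \<notin> C \<Longrightarrow> h x = 0"
  shows "integrable (lborel \<Otimes>\<^sub>M lborel) (\<lambda>(x, x'). g x' * k x' x * h x)"
proof -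
  have hm [measurable]: "h \<in> borel_measurable borel"
    using borel_measurable_integrable[OF h] by simp
  have km: "(\<lambda>p. k (fst p) (snd p)) \<in> borel_measurable (borel \<Otimes>\<^sub>M borel)"
    using k by (simp add: borel_prod case_prod_beta')
  \<comment> \<open>The product space is ordered as \<open>(x, x')\<close>, conditioning state
    first, while \<open>k\<close> takes \<open>x'\<close> first; measurability is carried along the
    swap.\<close>
  have kx [measurable]: "(\<lambda>p. k (snd p) (fst p)) \<in> borel_measurable (borel \<Otimes>\<^sub>M borel)"
    using measurable_compose[OF _ km, of "\<lambda>p. (snd p, fst p)"] by simp
  have meas: "(\<lambda>(x, x'). g x' * k x' x * h x) \<in> borel_measurable (lborel \<Otimes>\<^sub>M lborel)"
    unfolding case_prod_beta' by measurable
  have norm_le: "(\<integral>x'. \<bar>g x' * k x' x * h x\<bar> \<partial>lborel) \<le> B * \<bar>h x\<bar>" for x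
  proof (cases "x \<in> C")
    case True
    have "(\<integral>x'. \<bar>g x' * k x' x * h x\<bar> \<partial>lborel) = (\<integral>x'. \<bar>g x' * k x' x\<bar> \<partial>lborel) * \<bar>h x\<bar>"
      by (simp add: abs_mult)
    then show ?thesis
      using density_integrable_mult(2)[OF dens(1)[OF True] dens(2)[OF True] g bound]
      by (simp add: mult_right_mono)
  qed (simp add: h0)
  show ?thesis
  proof (rule lborel_pair.Fubini_integrable[OF meas])
    show "integrable lborel (\<lambda>x. \<integral>x'. norm (case (x, x') of (x, x') \<Rightarrow> g x' * k x' x * h x) \<partial>lborel)"
    proof (rule Bochner_Integration.integrable_bound)
      show "integrable lborel (\<lambda>x. B * \<bar>h x\<bar>)"
        using h by simp
      show "(\<lambda>x. \<integral>x'. norm (case (x, x') of (x, x') \<Rightarrow> g x' * k x' x * h x) \<partial>lborel)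
          \<in> borel_measurable lborel"
        using meas by (intro lborel.borel_measurable_lebesgue_integral) (auto simp: case_prod_beta')
      show "AE x in lborel. norm (\<integral>x'. norm (case (x, x') of (x, x') \<Rightarrow> g x' * k x' x * h x) \<partial>lborel)
          \<le> norm (B * \<bar>h x\<bar>)"
        by (auto intro!: AE_I2 order_trans[OF norm_le abs_ge_self])
    qed
  next
    have "integrable lborel (\<lambda>x'. g x' * k x' x * h x)" for x
      using density_integrable_mult(1)[OF dens g bound] h0 by (cases "x \<in> C") auto
    then show "AE x in lborel. integrable lborel (\<lambda>x'. case (x, x') of (x, x') \<Rightarrow> g x' * k x' x * h x)"
      by simp
  qed
qed

text \<open>The kernel carries \<open>h\<close> forward to a function of \<open>x'\<close> and
  \<open>g\<close> backward to a function of \<open>x\<close>; both pairings are the same double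
  integral. The two integrability claims later allow sums over modes to be split under the
  integral.\<close>

lemma kernel_Fubini:
  fixes k :: "'x::euclidean_space \<Rightarrow> 'x \<Rightarrow> real" and g h :: "'x \<Rightarrow> real"
  assumes "(\<lambda>(x', x). k x' x) \<in> borel_measurable borel"
    and "\<And>x x'. x \<in> C \<Longrightarrow> 0 \<le> k x' x"
      "\<And>x. x \<in> C \<Longrightarrow> has_bochner_integral lborel (\<lambda>x'. k x' x) 1"
    and "g \<in> borel_measurable borel" "\<And>x'. \<bar>g x'\<bar> \<le> B"
    and "integrable lborel h" "\<And>x. x \<notin> C \<Longrightarrow> h x = 0"
  shows "integrable lborel (\<lambda>x'. g x' * (\<integral>x. k x' x * h x \<partial>lborel))"
    and "integrable lborel (\<lambda>x. (\<integral>x'. g x' * k x' x \<partial>lborel) * h x)"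
    and "(\<integral>x'. g x' * (\<integral>x. k x' x * h x \<partial>lborel) \<partial>lborel)
       = (\<integral>x. (\<integral>x'. g x' * k x' x \<partial>lborel) * h x \<partial>lborel)"
proof -
  note int = kernel_integrable_pair[OF assms]
  have inner: "(\<integral>x. g x' * k x' x * h x \<partial>lborel) = g x' * (\<integral>x. k x' x * h x \<partial>lborel)" for x'
    by (simp add: mult.assoc)
  show "integrable lborel (\<lambda>x'. g x' * (\<integral>x. k x' x * h x \<partial>lborel))"
    using lborel_pair.integrable_snd[OF int] inner by simp
  show "integrable lborel (\<lambda>x. (\<integral>x'. g x' * k x' x \<partial>lborel) * h x)"
    using lborel_pair.integrable_fst[OF int] by simp
  show "(\<integral>x'. g x' * (\<integral>x. k x' x * h x \<partial>lborel) \<partial>lborel)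
       = (\<integral>x. (\<integral>x'. g x' * k x' x \<partial>lborel) * h x \<partial>lborel)"
    using lborel_pair.Fubini_integral[OF int] inner by simp
qed


text \<open>
  Boundedness suffices to make the pairing with every integrable function finite, and it survives
  the adjoint because \<open>Tx\<close>, \<open>Tq\<close>, \<open>Qobs\<close> and \<open>phi\<close> are (sub)probabilities on the safe set.
\<close>

definition bounded_test :: "('n::finite, 'q, 'u, 'a, 'b) hybrid_model \<Rightarrow> ((real ^ 'n) \<times> 'q \<Rightarrow> real) \<Rightarrow> bool"
  where "bounded_test M \<alpha> \<longleftrightarrow> zero_extended M \<alpha> \<and>
    (\<forall>q. (\<lambda>x. \<alpha> (x, q)) \<in> borel_measurable borel) \<and> (\<exists>B. \<forall>s. \<bar>\<alpha> s\<bar> \<le> B)"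

text \<open>The adjoint of \<open>Phi M y u\<close> under \<open>pairing\<close>, known in partially
  observed control as the backup of an alpha-vector. The factors from \<open>safe\<close> and
  \<open>Tq\<close> do not depend on \<open>x'\<close> and stay outside the integral.\<close>

definition backup :: "('n::finite, 'q::finite, 'u, 'a::finite, 'b::finite) hybrid_model \<Rightarrow>
    'a \<times> 'b \<Rightarrow> 'u \<Rightarrow> ((real ^ 'n) \<times> 'q \<Rightarrow> real) \<Rightarrow> ((real ^ 'n) \<times> 'q \<Rightarrow> real)"
  where "backup M y u \<alpha> = (\<lambda>(x, q). \<Sum>q'\<in>UNIV.
    real CARD('a) * real CARD('b) * Qobs M q' (fst y) u *
    ((\<integral>x'. \<alpha> (x', q') * phi M (snd y) x' u * Tx M x' x u q' \<partial>lborel) *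
     (indicator (safe M) (x, q) * Tq M q' x q u)))"

lemma bounded_test_integrable:
  assumes "bounded_test M \<alpha>" "integrable lborel (\<lambda>x. \<sigma> (x, q))"
  shows "integrable lborel (\<lambda>x. \<alpha> (x, q) * \<sigma> (x, q))"
proof -
  obtain B where B: "\<And>s. \<bar>\<alpha> s\<bar> \<le> B" and m: "(\<lambda>x. \<alpha> (x, q)) \<in> borel_measurable borel"
    using assms(1) by (auto simp: bounded_test_def)
  \<comment> \<open>Evaluating the bound at any point gives the sign of \<open>B\<close>, so that
    \<open>B * \<sigma>\<close> dominates the product in norm.\<close>
  have "B \<ge> 0"
    using B[of undefined] by linarith
  moreover have "integrable lborel (\<lambda>x. B * \<sigma> (x, q))"
    using assms(2) by simp
  ultimately show ?thesis
    using assms(2) m B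
    by (elim Bochner_Integration.integrable_bound) (auto simp: abs_mult intro!: AE_I2 mult_right_mono)
qed

lemma le_one_if_sum_eq_one:
  fixes p :: "'c::finite \<Rightarrow> real"
  assumes "\<And>i. 0 \<le> p i" "(\<Sum>i\<in>UNIV. p i) = 1"
  shows "p i \<le> 1"
  using member_le_sum[of i UNIV p] assms by simp

section \<open>Bounds and measurability of the model data\<close>

context
  fixes M :: "('n::finite, 'q::finite, 'u, 'a::finite, 'b::finite) hybrid_model"
  assumes M: "hybrid_system M"
begin

lemma safe_cstates: "x \<notin> cstates M \<Longrightarrow> (x, q) \<notin> safe M"
  using M by (auto simp: hybrid_system_def)

text \<open>Inside \<open>cstates M\<close> these come from the probability axiom, outside from the
  zero extension. They are wanted at every point, since integrals over the next state run over the
  whole space.\<close>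

lemma phi_bounds: "0 \<le> phi M yx x u" "phi M yx x u \<le> 1"
proof -
  have *: "x \<in> cstates M \<Longrightarrow> (\<forall>yx. 0 \<le> phi M yx x u) \<and> (\<Sum>yx\<in>UNIV. phi M yx x u) = 1"
    "x \<notin> cstates M \<Longrightarrow> phi M yx x u = 0"
    using M unfolding hybrid_system_def by metis+
  then show "0 \<le> phi M yx x u"
    by (metis order_refl)
  from * show "phi M yx x u \<le> 1"
    using le_one_if_sum_eq_one[of "\<lambda>yx. phi M yx x u"] by (cases "x \<in> cstates M") auto
qed

lemma Qobs_nonneg: "0 \<le> Qobs M q yq u"
  using M unfolding hybrid_system_def by metis

lemma Tq_bounds:
  assumes "x \<in> cstates M"
  shows "0 \<le> Tq M q' x q u" "Tq M q' x q u \<le> 1"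
proof -
  have *: "\<forall>q'. 0 \<le> Tq M q' x q u" "(\<Sum>q'\<in>UNIV. Tq M q' x q u) = 1"
    using M assms unfolding hybrid_system_def by metis+
  then show "0 \<le> Tq M q' x q u" "Tq M q' x q u \<le> 1"
    using le_one_if_sum_eq_one[of "\<lambda>q'. Tq M q' x q u"] by auto
qed

lemma Tx_density:
  assumes "x \<in> cstates M"
  shows "0 \<le> Tx M x' x u q'" "has_bochner_integral lborel (\<lambda>x'. Tx M x' x u q') 1"
  using M assms unfolding hybrid_system_def by metis+

lemma Tx_measurable: "(\<lambda>(x', x). Tx M x' x u q') \<in> borel_measurable borel"
  using M unfolding hybrid_system_def by metis

lemma Tq_measurable: "(\<lambda>x. Tq M q' x q u) \<in> borel_measurable borel"
  using M unfolding hybrid_system_def by metis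

lemma phi_measurable: "(\<lambda>x. phi M yx x u) \<in> borel_measurable borel"
  using M unfolding hybrid_system_def by metis

lemma safe_measurable: "(\<lambda>x. indicator (safe M) (x, q) :: real) \<in> borel_measurable borel"
proof -
  have "{x. (x, q) \<in> safe M} \<in> sets borel"
    using M unfolding hybrid_system_def by metis
  then have "(indicator {x. (x, q) \<in> safe M} :: _ \<Rightarrow> real) \<in> borel_measurable borel"
    by simp
  also have "(indicator {x. (x, q) \<in> safe M} :: _ \<Rightarrow> real) = (\<lambda>x. indicator (safe M) (x, q))"
    by (auto simp: indicator_def)
  finally show ?thesis .
qed

text \<open>\<open>Tq\<close> is controlled only on \<open>cstates M\<close>; the indicator kills
  the product everywhere else.\<close>

lemma abs_safe_Tq_le_one: "\<bar>indicator (safe M) (x, q) * Tq M q' x q u\<bar> \<le> 1"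
  using safe_cstates[of x q] Tq_bounds[of x q' q u] by (cases "x \<in> cstates M") (auto simp: indicator_def)

lemma test_phi_bound:
  assumes "\<And>s. \<bar>\<alpha> s\<bar> \<le> B"
  shows "\<bar>\<alpha> (x, q) * phi M yx x u\<bar> \<le> B"
proof -
  have "\<bar>\<alpha> (x, q)\<bar> * phi M yx x u \<le> B * 1"
    using assms[of "(x, q)"] phi_bounds by (intro mult_mono) auto
  then show ?thesis
    using phi_bounds by (simp add: abs_mult)
qed

section \<open>Bounded tests and their backups\<close>

lemma bounded_test_indicator_safe: "bounded_test M (indicator (safe M))"
  unfolding bounded_test_def zero_extended_def
  using safe_cstates safe_measurable by (auto simp: indicator_def intro!: exI[of _ 1])

lemma sufficient_statisticsD:
  assumes "\<sigma> \<in> sufficient_statistics M"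
  shows "\<sigma> s \<ge> 0" "integrable lborel (\<lambda>x. \<sigma> (x, q))" "x \<notin> cstates M \<Longrightarrow> \<sigma> (x, q) = 0"
  using assms by (cases s; auto simp: sufficient_statistics_def zero_extended_def)+

lemma bounded_test_backup:
  assumes "bounded_test M \<alpha>"
  shows "bounded_test M (backup M y u \<alpha>)"
proof -
  obtain B where B: "\<And>s. \<bar>\<alpha> s\<bar> \<le> B" and m: "\<And>q. (\<lambda>x. \<alpha> (x, q)) \<in> borel_measurable borel"
    using assms by (auto simp: bounded_test_def)
  have B0: "0 \<le> B"
    using B[of undefined] by linarith
  let ?I = "\<lambda>q' x. \<integral>x'. \<alpha> (x', q') * phi M (snd y) x' u * Tx M x' x u q' \<partial>lborel"
  let ?c = "\<lambda>q'. real CARD('a) * real CARD('b) * Qobs M q' (fst y) u"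
  \<comment> \<open>An integral over \<open>x'\<close> is measurable in the parameter
    \<open>x\<close> once the integrand is jointly measurable.\<close>
  have "?I q' \<in> borel_measurable lborel" for q'
  proof (rule lborel.borel_measurable_lebesgue_integral)
    have km: "(\<lambda>p. Tx M (fst p) (snd p) u q') \<in> borel_measurable (borel \<Otimes>\<^sub>M borel)"
      using Tx_measurable by (simp add: borel_prod case_prod_beta')
    have [measurable]: "(\<lambda>p. Tx M (snd p) (fst p) u q') \<in> borel_measurable (borel \<Otimes>\<^sub>M borel)"
      using measurable_compose[OF _ km, of "\<lambda>p. (snd p, fst p)"] by simp
    note [measurable] = m phi_measurable
    show "(\<lambda>(x, x'). \<alpha> (x', q') * phi M (snd y) x' u * Tx M x' x u q')
        \<in> borel_measurable (lborel \<Otimes>\<^sub>M lborel)"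
      unfolding case_prod_beta' by measurable
  qed
  then have I_meas: "?I q' \<in> borel_measurable borel" for q'
    by simp
  have meas: "(\<lambda>x. backup M y u \<alpha> (x, q)) \<in> borel_measurable borel" for q
    unfolding backup_def prod.case
    by (intro borel_measurable_sum borel_measurable_times borel_measurable_const
        I_meas safe_measurable Tq_measurable)
  have I: "\<bar>?I q' x\<bar> \<le> B" if "x \<in> cstates M" for q' x
  proof (rule order_trans[OF integral_abs_bound density_integrable_mult(2)[OF Tx_density[OF that]]])
    show "(\<lambda>x'. \<alpha> (x', q') * phi M (snd y) x' u) \<in> borel_measurable borel"
      using m phi_measurable by (rule borel_measurable_times)
    show "\<bar>\<alpha> (x', q') * phi M (snd y) x' u\<bar> \<le> B" for x'
      using B by (rule test_phi_bound)
  qed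
  have bound: "\<bar>backup M y u \<alpha> (x, q)\<bar> \<le> (\<Sum>q'\<in>UNIV. ?c q' * B)" for x q
    unfolding backup_def prod.case
  proof (rule sum_abs[THEN order_trans], rule sum_mono)
    fix q'
    \<comment> \<open>The bound on \<open>?I\<close> is available only on \<open>cstates M\<close>;
      elsewhere the indicator makes the product zero.\<close>
    have "\<bar>?I q' x * (indicator (safe M) (x, q) * Tq M q' x q u)\<bar> \<le> B"
    proof (cases "x \<in> cstates M")
      case True
      then show ?thesis
        using mult_mono[OF I abs_safe_Tq_le_one] B0 by (simp add: abs_mult)
    next
      case False
      then show ?thesis
        using safe_cstates B0 by simp
    qed
    moreover have "0 \<le> ?c q'"
      using Qobs_nonneg by simp
    ultimately show "\<bar>?c q' * (?I q' x * (indicator (safe M) (x, q) * Tq M q' x q u))\<bar> \<le> ?c q' * B"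
      unfolding abs_mult[of "?c q'"] by (simp only: abs_of_nonneg mult_left_mono)
  qed
  have "zero_extended M (backup M y u \<alpha>)"
    using safe_cstates by (simp add: zero_extended_def backup_def)
  with meas bound show ?thesis
    unfolding bounded_test_def split_paired_All by blast
qed

section \<open>The update operator and its adjoint\<close>

lemma integrable_safe_Tq:
  assumes "\<sigma> \<in> sufficient_statistics M"
  shows "integrable lborel (\<lambda>x. indicator (safe M) (x, q) * Tq M q' x q u * \<sigma> (x, q))"
proof (rule Bochner_Integration.integrable_bound)
  show "integrable lborel (\<lambda>x. \<sigma> (x, q))"
    using assms by (rule sufficient_statisticsD)
  then show "(\<lambda>x. indicator (safe M) (x, q) * Tq M q' x q u * \<sigma> (x, q)) \<in> borel_measurable lborel"
    using safe_measurable Tq_measurable by (intro borel_measurable_times) auto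
  show "AE x in lborel. norm (indicator (safe M) (x, q) * Tq M q' x q u * \<sigma> (x, q)) \<le> norm (\<sigma> (x, q))"
    using mult_right_mono[OF abs_safe_Tq_le_one abs_ge_zero] by (simp add: abs_mult)
qed

text \<open>Here \<open>h\<close> collects the factors of the update that depend on the preceding
  state, and vanishes off \<open>cstates M\<close>. The weight \<open>g\<close> stays free:
  \<open>phi\<close> alone gives integrability of the update, a test function times
  \<open>phi\<close> gives the adjoint.\<close>

lemma Phi_kernel_Fubini:
  fixes q q' :: 'q and u :: 'u
  assumes "\<sigma> \<in> sufficient_statistics M"
    and g: "g \<in> borel_measurable borel" "\<And>x'. \<bar>g x'\<bar> \<le> B"
  defines "h \<equiv> \<lambda>x. indicator (safe M) (x, q) * Tq M q' x q u * \<sigma> (x, q)"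
  shows "integrable lborel (\<lambda>x'. g x' * (\<integral>x. Tx M x' x u q' * h x \<partial>lborel))"
    and "integrable lborel (\<lambda>x. (\<integral>x'. g x' * Tx M x' x u q' \<partial>lborel) * h x)"
    and "(\<integral>x'. g x' * (\<integral>x. Tx M x' x u q' * h x \<partial>lborel) \<partial>lborel)
       = (\<integral>x. (\<integral>x'. g x' * Tx M x' x u q' \<partial>lborel) * h x \<partial>lborel)"
proof -
  note * = kernel_Fubini[where C = "cstates M", OF Tx_measurable Tx_density g]
  have h: "integrable lborel h" "x \<notin> cstates M \<Longrightarrow> h x = 0" for x
    using integrable_safe_Tq[OF assms(1)] safe_cstates by (auto simp: h_def)
  show "integrable lborel (\<lambda>x'. g x' * (\<integral>x. Tx M x' x u q' * h x \<partial>lborel))"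
    by (rule *(1)) (use h in auto)
  show "integrable lborel (\<lambda>x. (\<integral>x'. g x' * Tx M x' x u q' \<partial>lborel) * h x)"
    by (rule *(2)) (use h in auto)
  show "(\<integral>x'. g x' * (\<integral>x. Tx M x' x u q' * h x \<partial>lborel) \<partial>lborel)
       = (\<integral>x. (\<integral>x'. g x' * Tx M x' x u q' \<partial>lborel) * h x \<partial>lborel)"
    by (rule *(3)) (use h in auto)
qed

text \<open>Moving \<open>phi\<close> inside the sum over modes gives each summand the shape
  \<open>g x' * (integral of kernel times h)\<close> treated by
  \<open>Phi_kernel_Fubini\<close>.\<close>

lemma Phi_eq:
  "Phi M y u \<sigma> (x', q') = real CARD('a) * real CARD('b) * Qobs M q' (fst y) u *
     (\<Sum>q\<in>UNIV. phi M (snd y) x' u *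
       (\<integral>x. Tx M x' x u q' * (indicator (safe M) (x, q) * Tq M q' x q u * \<sigma> (x, q)) \<partial>lborel))"
  by (simp add: Phi_def tau_def sum_distrib_left mult_ac)

text \<open>Lets the induction hypothesis for the value function be applied to the updated
  statistic. Integrability is Fubini with weight \<open>phi\<close>.\<close>

lemma Phi_sufficient_statistics:
  assumes "\<sigma> \<in> sufficient_statistics M"
  shows "Phi M y u \<sigma> \<in> sufficient_statistics M"
proof -
  have abs_phi: "\<bar>phi M (snd y) x' u\<bar> \<le> 1" for x'
    using phi_bounds by simp
  have "integrable lborel (\<lambda>x'. Phi M y u \<sigma> (x', q'))" for q'
    unfolding Phi_eq
    using Phi_kernel_Fubini(1)[OF assms phi_measurable abs_phi]
    by (intro integrable_mult_right Bochner_Integration.integrable_sum)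
  moreover have "0 \<le> Phi M y u \<sigma> (x', q')" for x' q'
  proof -
    have "0 \<le> Tx M x' x u q' * (indicator (safe M) (x, q) * Tq M q' x q u * \<sigma> (x, q))" for x q
      using Tx_density(1)[of x] Tq_bounds(1)[of x] safe_cstates[of x q] sufficient_statisticsD(1)[OF assms]
      by (cases "x \<in> cstates M") auto
    then have "0 \<le> (\<integral>x. Tx M x' x u q' * (indicator (safe M) (x, q) * Tq M q' x q u * \<sigma> (x, q)) \<partial>lborel)" for q
      by (rule Bochner_Integration.integral_nonneg)
    then show ?thesis
      unfolding Phi_eq using Qobs_nonneg phi_bounds(1)
      by (intro mult_nonneg_nonneg sum_nonneg) auto
  qed
  \<comment> \<open>The factor \<open>phi\<close> removes whatever mass \<open>Tx\<close> puts
    outside \<open>cstates M\<close>.\<close>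
  moreover have "zero_extended M (Phi M y u \<sigma>)"
    using M by (auto simp: zero_extended_def Phi_def hybrid_system_def)
  ultimately show ?thesis
    by (auto simp: sufficient_statistics_def)
qed

text \<open>Fubini is applied for each pair of modes \<open>q'\<close>, \<open>q\<close>, and the
  two finite sums over modes are then exchanged.\<close>

lemma pairing_Phi:
  assumes "bounded_test M \<alpha>" "\<sigma> \<in> sufficient_statistics M"
  shows "pairing \<alpha> (Phi M y u \<sigma>) = pairing (backup M y u \<alpha>) \<sigma>"
proof -
  obtain B where B: "\<And>s. \<bar>\<alpha> s\<bar> \<le> B" and m: "\<And>q. (\<lambda>x. \<alpha> (x, q)) \<in> borel_measurable borel"
    using assms by (auto simp: bounded_test_def)
  let ?c = "\<lambda>q'. real CARD('a) * real CARD('b) * Qobs M q' (fst y) u"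
  let ?g = "\<lambda>q' x'. \<alpha> (x', q') * phi M (snd y) x' u"
  let ?h = "\<lambda>q' q x. indicator (safe M) (x, q) * Tq M q' x q u * \<sigma> (x, q)"
  let ?L = "\<lambda>q' q x'. ?g q' x' * (\<integral>x. Tx M x' x u q' * ?h q' q x \<partial>lborel)"
  let ?R = "\<lambda>q' q x. (\<integral>x'. ?g q' x' * Tx M x' x u q' \<partial>lborel) * ?h q' q x"
  have g: "?g q' \<in> borel_measurable borel" "\<bar>?g q' x'\<bar> \<le> B" for q' x'
    using m phi_measurable test_phi_bound[OF B] by (auto intro: borel_measurable_times)
  note F = Phi_kernel_Fubini[OF assms(2) g]
  have "pairing \<alpha> (Phi M y u \<sigma>) = (\<Sum>q'\<in>UNIV. \<integral>x'. (\<Sum>q\<in>UNIV. ?c q' * ?L q' q x') \<partial>lborel)"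
    unfolding pairing_def Phi_eq by (simp add: sum_distrib_left mult_ac)
  also have "\<dots> = (\<Sum>q'\<in>UNIV. \<Sum>q\<in>UNIV. ?c q' * (\<integral>x'. ?L q' q x' \<partial>lborel))"
    \<comment> \<open>The integral passes through the sum because every summand is
      integrable.\<close>
    using F(1) by (subst Bochner_Integration.integral_sum) (auto intro!: integrable_mult_right)
  also have "\<dots> = (\<Sum>q'\<in>UNIV. \<Sum>q\<in>UNIV. ?c q' * (\<integral>x. ?R q' q x \<partial>lborel))"
    by (simp only: F(3))
  also have "\<dots> = (\<Sum>q\<in>UNIV. \<Sum>q'\<in>UNIV. ?c q' * (\<integral>x. ?R q' q x \<partial>lborel))"
    by (rule sum.swap)
  also have "\<dots> = (\<Sum>q\<in>UNIV. \<integral>x. (\<Sum>q'\<in>UNIV. ?c q' * ?R q' q x) \<partial>lborel)"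
    using F(2) by (subst Bochner_Integration.integral_sum) (auto intro!: integrable_mult_right)
  also have "\<dots> = pairing (backup M y u \<alpha>) \<sigma>"
    unfolding pairing_def backup_def by (simp only: prod.case sum_distrib_right mult.assoc)
  finally show ?thesis .
qed

section \<open>Linearity of the pairing in the test function and in the statistic\<close>

lemma pairing_scaled_sum:
  fixes \<alpha> :: "'i \<Rightarrow> (real ^ 'n) \<times> 'q \<Rightarrow> real"
  assumes "\<And>i. i \<in> I \<Longrightarrow> bounded_test M (\<alpha> i)" "\<sigma> \<in> sufficient_statistics M"
  shows "pairing (\<lambda>s. c * (\<Sum>i\<in>I. \<alpha> i s)) \<sigma> = c * (\<Sum>i\<in>I. pairing (\<alpha> i) \<sigma>)"
proof -
  have "(\<integral>x. c * (\<Sum>i\<in>I. \<alpha> i (x, q)) * \<sigma> (x, q) \<partial>lborel)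
      = c * (\<Sum>i\<in>I. \<integral>x. \<alpha> i (x, q) * \<sigma> (x, q) \<partial>lborel)" for q
    using bounded_test_integrable[OF assms(1) sufficient_statisticsD(2)[OF assms(2)]]
    by (simp add: sum_distrib_right mult.assoc Bochner_Integration.integral_sum)
  then show ?thesis
    unfolding pairing_def by (simp add: sum_distrib_left[symmetric] sum.swap[of _ UNIV I])
qed

lemma pairing_convex_combination:
  assumes "bounded_test M \<alpha>" "\<sigma>1 \<in> sufficient_statistics M" "\<sigma>2 \<in> sufficient_statistics M"
  shows "pairing \<alpha> (\<lambda>s. c * \<sigma>1 s + d * \<sigma>2 s) = c * pairing \<alpha> \<sigma>1 + d * pairing \<alpha> \<sigma>2"
proof -
  note int = bounded_test_integrable[OF assms(1) sufficient_statisticsD(2)]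
  have "(\<integral>x. \<alpha> (x, q) * (c * \<sigma>1 (x, q) + d * \<sigma>2 (x, q)) \<partial>lborel)
      = (\<integral>x. c * (\<alpha> (x, q) * \<sigma>1 (x, q)) + d * (\<alpha> (x, q) * \<sigma>2 (x, q)) \<partial>lborel)" for q
    by (simp add: algebra_simps)
  also have "\<dots> q = c * (\<integral>x. \<alpha> (x, q) * \<sigma>1 (x, q) \<partial>lborel)
      + d * (\<integral>x. \<alpha> (x, q) * \<sigma>2 (x, q) \<partial>lborel)" for q
    using int[OF assms(2)] int[OF assms(3)] by simp
  finally show ?thesis
    unfolding pairing_def by (simp add: sum.distrib sum_distrib_left)
qed

lemma bounded_test_scaled_sum:
  fixes \<alpha> :: "'i \<Rightarrow> (real ^ 'n) \<times> 'q \<Rightarrow> real"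
  assumes "\<And>i. i \<in> I \<Longrightarrow> bounded_test M (\<alpha> i)"
  shows "bounded_test M (\<lambda>s. c * (\<Sum>i\<in>I. \<alpha> i s))"
proof -
  have "\<forall>i. \<exists>B. i \<in> I \<longrightarrow> (\<forall>s. \<bar>\<alpha> i s\<bar> \<le> B)"
    using assms unfolding bounded_test_def by blast
  then obtain B where B: "\<And>i s. i \<in> I \<Longrightarrow> \<bar>\<alpha> i s\<bar> \<le> B i"
    by metis
  have "\<bar>c * (\<Sum>i\<in>I. \<alpha> i s)\<bar> \<le> \<bar>c\<bar> * (\<Sum>i\<in>I. B i)" for s
    unfolding abs_mult using B by (intro mult_left_mono sum_abs[THEN order_trans] sum_mono) auto
  moreover have "(\<lambda>x. c * (\<Sum>i\<in>I. \<alpha> i (x, q))) \<in> borel_measurable borel" for q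
    using assms by (intro borel_measurable_times borel_measurable_sum) (auto simp: bounded_test_def)
  moreover have "zero_extended M (\<lambda>s. c * (\<Sum>i\<in>I. \<alpha> i s))"
    using assms by (auto simp: bounded_test_def zero_extended_def)
  ultimately show ?thesis
    unfolding bounded_test_def by blast
qed

section \<open>Backward induction for the value function\<close>

text \<open>Boundedness of the tests is carried through the induction because
  \<open>pairing_Phi\<close> and \<open>bounded_test_backup\<close> rely on it; nonemptiness of
  \<Gamma> gives \<open>Max\<close> its meaning.\<close>

lemma value_fn_max_pairing:
  assumes U: "finite (UNIV :: 'u set)" and "t \<le> T"
  shows "\<exists>\<Gamma>. finite \<Gamma> \<and> \<Gamma> \<noteq> {} \<and> (\<forall>\<alpha>\<in>\<Gamma>. bounded_test M \<alpha>) \<and>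
    (\<forall>\<sigma>\<in>sufficient_statistics M. value_fn M T t \<sigma> = Max ((\<lambda>\<alpha>. pairing \<alpha> \<sigma>) ` \<Gamma>))"
  using \<open>t \<le> T\<close>
proof (induction t rule: inc_induct)
  case base
  have "value_fn M T T \<sigma> = pairing (indicator (safe M)) \<sigma>" for \<sigma>
    by (simp add: value_fn.simps pairing_def mult.commute)
  then show ?case
    using bounded_test_indicator_safe by (intro exI[of _ "{indicator (safe M)}"]) auto
next
  case (step t)
  then obtain \<Gamma> where \<Gamma>: "finite \<Gamma>" "\<Gamma> \<noteq> {}" "\<And>\<alpha>. \<alpha> \<in> \<Gamma> \<Longrightarrow> bounded_test M \<alpha>"
    and V: "\<And>\<sigma>. \<sigma> \<in> sufficient_statistics M
      \<Longrightarrow> value_fn M T (Suc t) \<sigma> = Max ((\<lambda>\<alpha>. pairing \<alpha> \<sigma>) ` \<Gamma>)"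
    by blast
  define c where "c = 1 / (real CARD('a) * real CARD('b))"
  \<comment> \<open>A pair \<open>(u, f)\<close> is one step of a policy: apply \<open>u\<close>,
    and after observing \<open>y\<close> continue with the functional \<open>f y\<close>. The factor
    \<open>c\<close> is the reference probability of each observation.\<close>
  define \<beta> where "\<beta> = (\<lambda>(u, f :: 'a \<times> 'b \<Rightarrow> _) s. c * (\<Sum>y\<in>UNIV. backup M y u (f y) s))"
  \<comment> \<open>\<open>PiE\<close> over the full type is the set of all functions into \<Gamma>,
    in a form for which finiteness follows from \<open>finite_PiE\<close>.\<close>
  define J where "J = (UNIV :: 'u set) \<times> (UNIV \<rightarrow>\<^sub>E \<Gamma> :: ('a \<times> 'b \<Rightarrow> _) set)"
  have c: "c \<ge> 0"
    by (simp add: c_def)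
  have J: "finite J" "J \<noteq> {}"
    using U \<Gamma> by (auto simp: J_def PiE_eq_empty_iff intro!: finite_PiE)
  have J_iff: "(u, f) \<in> J \<longleftrightarrow> (\<forall>y. f y \<in> \<Gamma>)" for u f
    by (simp add: J_def PiE_iff)
  have backup_test: "bounded_test M (backup M y u (f y))" if "(u, f) \<in> J" for u f y
    using that \<Gamma>(3) J_iff by (intro bounded_test_backup) blast
  have test: "bounded_test M (\<beta> (u, f))" if "(u, f) \<in> J" for u f
    unfolding \<beta>_def prod.case using backup_test[OF that] by (intro bounded_test_scaled_sum)
  have "value_fn M T t \<sigma> = Max ((\<lambda>\<alpha>. pairing \<alpha> \<sigma>) ` \<beta> ` J)"
    if \<sigma>: "\<sigma> \<in> sufficient_statistics M" for \<sigma>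
  proof -
    let ?P = "\<lambda>y u. Max ((\<lambda>\<alpha>. pairing \<alpha> (Phi M y u \<sigma>)) ` \<Gamma>)"
    let ?W = "\<lambda>u. c * (\<Sum>y\<in>UNIV. ?P y u)"
    have pairing_\<beta>: "pairing (\<beta> (u, f)) \<sigma> = c * (\<Sum>y\<in>UNIV. pairing (f y) (Phi M y u \<sigma>))"
      if "(u, f) \<in> J" for u f
    proof -
      have "pairing (\<beta> (u, f)) \<sigma> = c * (\<Sum>y\<in>UNIV. pairing (backup M y u (f y)) \<sigma>)"
        unfolding \<beta>_def prod.case using backup_test[OF that] \<sigma> by (rule pairing_scaled_sum)
      moreover have "pairing (backup M y u (f y)) \<sigma> = pairing (f y) (Phi M y u \<sigma>)" for y
        using that \<Gamma>(3) J_iff \<sigma> by (intro pairing_Phi[symmetric]) blast+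
      ultimately show ?thesis
        by simp
    qed
    have val_Max: "value_fn M T t \<sigma> = Max (range ?W)"
    proof -
      have "value_fn M T t \<sigma> = (SUP u. c * (\<Sum>y\<in>UNIV. value_fn M T (Suc t) (Phi M y u \<sigma>)))"
        using step.hyps by (subst value_fn.simps) (simp add: c_def)
      also have "\<dots> = (SUP u. ?W u)"
        by (simp only: V[OF Phi_sufficient_statistics[OF \<sigma>]])
      \<comment> \<open>With finitely many actions the supremum is over a finite nonempty set of
        reals, hence attained.\<close>
      also have "\<dots> = Max (range ?W)"
        using U by (intro cSup_eq_Max) auto
      finally show ?thesis .
    qed
    have "Max ((\<lambda>\<alpha>. pairing \<alpha> \<sigma>) ` \<beta> ` J) = Max (range ?W)"
    proof (rule Max_eqI)
      show "finite ((\<lambda>\<alpha>. pairing \<alpha> \<sigma>) ` \<beta> ` J)"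
        by (intro finite_imageI J(1))
    next
      fix r assume "r \<in> (\<lambda>\<alpha>. pairing \<alpha> \<sigma>) ` \<beta> ` J"
      then obtain j where "j \<in> J" "r = pairing (\<beta> j) \<sigma>"
        by blast
      then obtain u f where uf: "(u, f) \<in> J" "r = pairing (\<beta> (u, f)) \<sigma>"
        by (cases j) blast
      \<comment> \<open>For each \<open>y\<close> the chosen \<open>f y\<close> is one of the
        competitors in \<open>?P y u\<close>; summation and the factor \<open>c\<close>,
        nonnegative, preserve the inequality.\<close>
      have "r \<le> ?W u"
        unfolding uf(2) pairing_\<beta>[OF uf(1)]
      proof (intro mult_left_mono sum_mono Max_ge c)
        show "pairing (f y) (Phi M y u \<sigma>) \<in> (\<lambda>\<alpha>. pairing \<alpha> (Phi M y u \<sigma>)) ` \<Gamma>" for y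
          using uf(1) J_iff by blast
      qed (use \<Gamma>(1) in simp)
      also have "\<dots> \<le> Max (range ?W)"
        by (intro Max_ge finite_imageI U rangeI)
      finally show "r \<le> Max (range ?W)" .
    next
      \<comment> \<open>Attainment: take an optimal \<open>u\<close> and, separately for each
        \<open>y\<close>, a maximizer \<open>f y\<close>. The choices for different \<open>y\<close>
        are independent, so the sum of maxima is reached by one \<open>f\<close>. This
        \<open>f\<close> varies with \<sigma>, but \<open>J\<close> does not.\<close>
      have "Max (range ?W) \<in> range ?W"
        using U by (intro Max_in) auto
      then obtain u where u: "Max (range ?W) = ?W u"
        by auto
      have "?P y u \<in> (\<lambda>\<alpha>. pairing \<alpha> (Phi M y u \<sigma>)) ` \<Gamma>" for y
        using \<Gamma> by (intro Max_in) auto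
      then have "\<forall>y. \<exists>\<alpha>\<in>\<Gamma>. pairing \<alpha> (Phi M y u \<sigma>) = ?P y u"
        by (metis (no_types, lifting) imageE)
      then obtain f where f: "\<And>y. f y \<in> \<Gamma>" "\<And>y. pairing (f y) (Phi M y u \<sigma>) = ?P y u"
        by metis
      then have "(u, f) \<in> J"
        using J_iff by blast
      moreover from this have "pairing (\<beta> (u, f)) \<sigma> = ?W u"
        by (simp add: pairing_\<beta> f)
      ultimately show "Max (range ?W) \<in> (\<lambda>\<alpha>. pairing \<alpha> \<sigma>) ` \<beta> ` J"
        unfolding u by (metis imageI)
    qed
    with val_Max show ?thesis
      by simp
  qed
  with J test show ?case
    by (intro exI[of _ "\<beta> ` J"]) auto
qed

section \<open>Convexity and the final statement\<close>

lemma convex_combination_sufficient_statistics: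
  assumes "\<sigma>1 \<in> sufficient_statistics M" "\<sigma>2 \<in> sufficient_statistics M" "0 \<le> c" "0 \<le> d"
  shows "(\<lambda>s. c * \<sigma>1 s + d * \<sigma>2 s) \<in> sufficient_statistics M"
  using assms by (auto simp: sufficient_statistics_def zero_extended_def)

end

text \<open>The integrability clause certifies that each pairing is a genuine integral and not the
  default value 0 of the Bochner integral. Convexity follows from the representation as a maximum of
  linear functionals.\<close>

theorem mainTheorem3:
  fixes M :: "('n::finite, 'q::finite, 'u, 'a::finite, 'b::finite) hybrid_model"
    and T t :: nat
  assumes "hybrid_system M"
    and "finite (UNIV :: 'u set)"
    and "t \<le> T"
  shows "(\<exists>\<Gamma> :: ((real ^ 'n) \<times> 'q \<Rightarrow> real) set.
           finite \<Gamma> \<and> \<Gamma> \<noteq> {} \<and>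
           (\<forall>\<alpha>\<in>\<Gamma>. zero_extended M \<alpha>) \<and>
           (\<forall>\<sigma>\<in>sufficient_statistics M.
              (\<forall>\<alpha>\<in>\<Gamma>. \<forall>q. integrable lborel (\<lambda>x. \<alpha> (x, q) * \<sigma> (x, q))) \<and>
              value_fn M T t \<sigma> = Max ((\<lambda>\<alpha>. pairing \<alpha> \<sigma>) ` \<Gamma>))) \<and>
         (\<forall>\<sigma>1\<in>sufficient_statistics M. \<forall>\<sigma>2\<in>sufficient_statistics M. \<forall>c\<in>{0..1}.
           value_fn M T t (\<lambda>s. c * \<sigma>1 s + (1 - c) * \<sigma>2 s)
             \<le> c * value_fn M T t \<sigma>1 + (1 - c) * value_fn M T t \<sigma>2)"
proof -
  note M = assms(1)
  obtain \<Gamma> where \<Gamma>: "finite \<Gamma>" "\<Gamma> \<noteq> {}" "\<And>\<alpha>. \<alpha> \<in> \<Gamma> \<Longrightarrow> bounded_test M \<alpha>"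
    and V: "\<And>\<sigma>. \<sigma> \<in> sufficient_statistics M \<Longrightarrow> value_fn M T t \<sigma> = Max ((\<lambda>\<alpha>. pairing \<alpha> \<sigma>) ` \<Gamma>)"
    using value_fn_max_pairing[OF assms] by blast
  have "value_fn M T t (\<lambda>s. c * \<sigma>1 s + (1 - c) * \<sigma>2 s)
      \<le> c * value_fn M T t \<sigma>1 + (1 - c) * value_fn M T t \<sigma>2"
    if \<sigma>: "\<sigma>1 \<in> sufficient_statistics M" "\<sigma>2 \<in> sufficient_statistics M" and c: "c \<in> {0..1}" for \<sigma>1 \<sigma>2 c
  proof -
    let ?s = "\<lambda>s. c * \<sigma>1 s + (1 - c) * \<sigma>2 s"
    have V_ge: "pairing \<alpha> \<sigma> \<le> value_fn M T t \<sigma>"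
      if "\<alpha> \<in> \<Gamma>" "\<sigma> \<in> sufficient_statistics M" for \<alpha> \<sigma>
      unfolding V[OF that(2)] using \<Gamma>(1) that(1) by (intro Max_ge finite_imageI imageI)
    have s: "?s \<in> sufficient_statistics M"
      using \<sigma> c by (intro convex_combination_sufficient_statistics[OF M]) auto
    \<comment> \<open>One \<alpha> attains the maximum at the mixture; it is linear there, and at
      \<sigma>1 and \<sigma>2 it lies below the respective maxima.\<close>
    have "Max ((\<lambda>\<alpha>. pairing \<alpha> ?s) ` \<Gamma>) \<in> (\<lambda>\<alpha>. pairing \<alpha> ?s) ` \<Gamma>"
      using \<Gamma>(1,2) by (intro Max_in) auto
    then obtain \<alpha> where \<alpha>: "\<alpha> \<in> \<Gamma>" "value_fn M T t ?s = pairing \<alpha> ?s"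
      unfolding V[OF s, symmetric] by (elim imageE)
    have "pairing \<alpha> ?s = c * pairing \<alpha> \<sigma>1 + (1 - c) * pairing \<alpha> \<sigma>2"
      using \<Gamma>(3)[OF \<alpha>(1)] \<sigma> by (rule pairing_convex_combination[OF M])
    also have "\<dots> \<le> c * value_fn M T t \<sigma>1 + (1 - c) * value_fn M T t \<sigma>2"
      using V_ge[OF \<alpha>(1)] \<sigma> c by (intro add_mono mult_left_mono) auto
    finally show ?thesis
      using \<alpha>(2) by simp
  qed
  moreover have "integrable lborel (\<lambda>x. \<alpha> (x, q) * \<sigma> (x, q))"
    if "\<alpha> \<in> \<Gamma>" "\<sigma> \<in> sufficient_statistics M" for \<alpha> \<sigma> q
    using \<Gamma>(3)[OF that(1)] sufficient_statisticsD(2)[OF M that(2)] by (rule bounded_test_integrable)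
  moreover have "\<forall>\<alpha>\<in>\<Gamma>. zero_extended M \<alpha>"
    using \<Gamma>(3) by (simp add: bounded_test_def)
  ultimately show ?thesis
    using \<Gamma>(1,2) V by (intro conjI exI[of _ \<Gamma>] ballI allI) simp_all
qed

end
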